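(* Let $f,g:[0,\infty)\to\mathbb{R}$ be convex with $f(1)=g(1)=0$. Suppose that for some function $\phi$ the inequality $$D_f(p\|q)\le\phi\bigl(D_g(p\|q)\bigr)$$ between classical divergences holds for any classical probability distributions $p,q$ (of common finite length). Then any quantum $f$-divergence $D_f(\cdot\|\cdot)$ satisfies $$D_f(\rho\|\sigma)\le\phi\bigl(D_g^{\max}(\rho\|\sigma)\bigr)$$ for any quantum states $\rho,\sigma$ on a finite-dimensional Hilbert space with $\sigma$ invertible, where $D_g^{\max}(\rho\|\sigma)=\operatorname{Tr}\bigl(\sigma^{1/2} g(\sigma^{-1/2}\rho\,\sigma^{-1/2})\,\sigma^{1/2}\bigr)$.
   Context: A quantum state is a positive semidefinite operator of trace $1$ on a finite-dimensional complex Hilbert space. A quantum channel is a completely positive trace-preserving linear map. For positive semidefinite $X$, $g(X)$ is defined by functional calculus. Classical $f$-divergence: for probability distributions $p=(p_1,\dots,p_n)$, $q=(q_1,\dots,q_n)$, $D_f(p\|q)=\sum_{i} q_i\, f(p_i/q_i)$ (with the usual conventions for terms with $q_i=0$: $0f(0/0)=0$ and $0f(a/0)=a\lim_{x\to\infty}f(x)/x$ for $a>0$); similarly for $g$. The function $\phi$ is a (possibly extended-)real-valued function defined on the values $[0,\infty]$ taken by $D_g$. Quantum $f$-divergence: any function $D_f(\rho\|\sigma)\in[0,\infty]$ of pairs of quantum states on a common finite-dimensional Hilbert space such that (i) if $\rho\sigma=\sigma\rho$, then $D_f(\rho\|\sigma)=D_f(p\|q)$, where $p$ and $q$ are the eigenvalues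 of $\rho$ and $\sigma$ listed along a common orthonormal eigenbasis; and (ii) $D_f(\mathcal{W}(\rho)\|\mathcal{W}(\sigma))\le D_f(\rho\|\sigma)$ for every quantum channel $\mathcal{W}$. *)

theory Defs
  imports
    "Jordan_Normal_Form.Schur_Decomposition"
    "HOL-Analysis.Convex"
    "HOL-Library.Extended_Real"
begin

section \<open>Classical f-divergences\<close>

definition prob_dist :: "nat \<Rightarrow> (nat \<Rightarrow> real) \<Rightarrow> bool" where
  "prob_dist n p \<longleftrightarrow> (\<forall>i<n. 0 \<le> p i) \<and> (\<Sum>i<n. p i) = 1"

text \<open>The limit exists in the extended reals for every convex \<open>f\<close> on the half-line.\<close>

definition slope_at_infinity :: "(real \<Rightarrow> real) \<Rightarrow> ereal" where
  "slope_at_infinity f = Lim at_top (\<lambda>x. ereal (f x / x))"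

definition f_div_term :: "(real \<Rightarrow> real) \<Rightarrow> real \<Rightarrow> real \<Rightarrow> ereal" where
  "f_div_term f a b =
     (if b = 0 then (if a = 0 then 0 else ereal a * slope_at_infinity f)
      else ereal (b * f (a / b)))"

definition classical_f_div ::
  "(real \<Rightarrow> real) \<Rightarrow> nat \<Rightarrow> (nat \<Rightarrow> real) \<Rightarrow> (nat \<Rightarrow> real) \<Rightarrow> ereal" where
  "classical_f_div f n p q = (\<Sum>i<n. f_div_term f (p i) (q i))"


section \<open>Operators, states and channels\<close>

text \<open>
  Finite-dimensional Hilbert spaces are represented by the coordinate spaces
  \<open>carrier_vec n\<close> and operators on them by \<open>carrier_mat n n\<close>.
\<close>

definition mat_trace :: "complex mat \<Rightarrow> complex" where
  "mat_trace A = (\<Sum>i<dim_row A. A $$ (i, i))"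

definition psd :: "nat \<Rightarrow> complex mat \<Rightarrow> bool" where
  "psd n A \<longleftrightarrow> A \<in> carrier_mat n n \<and> mat_adjoint A = A \<and>
     (\<forall>v \<in> carrier_vec n. 0 \<le> Re ((A *\<^sub>v v) \<bullet>c v))"

definition quantum_state :: "nat \<Rightarrow> complex mat \<Rightarrow> bool" where
  "quantum_state n \<rho> \<longleftrightarrow> psd n \<rho> \<and> mat_trace \<rho> = 1"

definition linear_map :: "nat \<Rightarrow> nat \<Rightarrow> (complex mat \<Rightarrow> complex mat) \<Rightarrow> bool" where
  "linear_map n m W \<longleftrightarrow>
     (\<forall>A \<in> carrier_mat n n. W A \<in> carrier_mat m m) \<and>
     (\<forall>A \<in> carrier_mat n n. \<forall>B \<in> carrier_mat n n. W (A + B) = W A + W B) \<and>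
     (\<forall>c. \<forall>A \<in> carrier_mat n n. W (c \<cdot>\<^sub>m A) = c \<cdot>\<^sub>m W A)"

text \<open>
  The space of dimension \<open>k * n\<close> is read as the tensor product of spaces of dimensions
  \<open>k\<close> and \<open>n\<close>, the basis vector number \<open>a * n + r\<close> (\<open>r < n\<close>) being the tensor product of
  the basis vectors \<open>a\<close> and \<open>r\<close>.  Thus \<open>ampliation k n m W\<close>, which applies \<open>W\<close> to each
  of the \<open>k * k\<close> blocks, is the tensor product of the identity map with \<open>W\<close>.
\<close>

definition block :: "nat \<Rightarrow> complex mat \<Rightarrow> nat \<Rightarrow> nat \<Rightarrow> complex mat" where
  "block n X a b = mat n n (\<lambda>(r, c). X $$ (a * n + r, b * n + c))"

definition ampliation ::
  "nat \<Rightarrow> nat \<Rightarrow> nat \<Rightarrow> (complex mat \<Rightarrow> complex mat) \<Rightarrow> complex mat \<Rightarrow> complex mat" where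
  "ampliation k n m W X =
     mat (k * m) (k * m) (\<lambda>(i, j). W (block n X (i div m) (j div m)) $$ (i mod m, j mod m))"

definition completely_positive ::
  "nat \<Rightarrow> nat \<Rightarrow> (complex mat \<Rightarrow> complex mat) \<Rightarrow> bool" where
  "completely_positive n m W \<longleftrightarrow>
     (\<forall>k X. psd (k * n) X \<longrightarrow> psd (k * m) (ampliation k n m W X))"

definition trace_preserving :: "nat \<Rightarrow> (complex mat \<Rightarrow> complex mat) \<Rightarrow> bool" where
  "trace_preserving n W \<longleftrightarrow> (\<forall>A \<in> carrier_mat n n. mat_trace (W A) = mat_trace A)"

definition quantum_channel :: "nat \<Rightarrow> nat \<Rightarrow> (complex mat \<Rightarrow> complex mat) \<Rightarrow> bool" where
  "quantum_channel n m W \<longleftrightarrow>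
     linear_map n m W \<and> completely_positive n m W \<and> trace_preserving n W"


section \<open>Spectral decompositions and functional calculus\<close>

definition unitary_mat :: "nat \<Rightarrow> complex mat \<Rightarrow> bool" where
  "unitary_mat n U \<longleftrightarrow> U \<in> carrier_mat n n \<and>
     U * mat_adjoint U = 1\<^sub>m n \<and> mat_adjoint U * U = 1\<^sub>m n"

text \<open>
  The columns of \<open>U\<close> form an orthonormal eigenbasis of \<open>A\<close>, and \<open>d\<close> lists the
  corresponding (real) eigenvalues.
\<close>

definition spectral_decomp ::
  "nat \<Rightarrow> complex mat \<Rightarrow> complex mat \<Rightarrow> (nat \<Rightarrow> real) \<Rightarrow> bool" where
  "spectral_decomp n A U d \<longleftrightarrow> unitary_mat n U \<and>
     A = U * mat_diag n (\<lambda>i. complex_of_real (d i)) * mat_adjoint U"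

definition mat_fun :: "(real \<Rightarrow> real) \<Rightarrow> complex mat \<Rightarrow> complex mat" where
  "mat_fun h A = (THE B. \<exists>U d. spectral_decomp (dim_row A) A U d \<and>
                              spectral_decomp (dim_row A) B U (\<lambda>i. h (d i)))"

lemma mat_adjoint_carrier: "U \<in> carrier_mat n m \<Longrightarrow> mat_adjoint U \<in> carrier_mat m n"
  by (auto simp: mat_adjoint_def)

text \<open>The choice of the eigenbasis does not matter, so that \<open>mat_fun\<close> is well defined.\<close>

lemma spectral_decomp_fun_unique:
  assumes "spectral_decomp n A U d" "spectral_decomp n A V e"
    and "spectral_decomp n B U (\<lambda>i. h (d i))" "spectral_decomp n C V (\<lambda>i. h (e i))"
  shows "B = C"
proof -
  let ?D = "\<lambda>d. mat_diag n (\<lambda>i. complex_of_real (d i))"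
  have cU: "U \<in> carrier_mat n n" and cV: "V \<in> carrier_mat n n"
    and U1: "U * mat_adjoint U = 1\<^sub>m n" and U2: "mat_adjoint U * U = 1\<^sub>m n"
    and V1: "V * mat_adjoint V = 1\<^sub>m n" and V2: "mat_adjoint V * V = 1\<^sub>m n"
    and AU: "A = U * ?D d * mat_adjoint U" and AV: "A = V * ?D e * mat_adjoint V"
    and BU: "B = U * ?D (\<lambda>i. h (d i)) * mat_adjoint U"
    and CV: "C = V * ?D (\<lambda>i. h (e i)) * mat_adjoint V"
    using assms by (auto simp: spectral_decomp_def unitary_mat_def)
  note cU' = mat_adjoint_carrier[OF cU] and cV' = mat_adjoint_carrier[OF cV]
  note assoc = assoc_mult_mat[where n\<^sub>1=n and n\<^sub>2=n and n\<^sub>3=n and n\<^sub>4=n]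
  note cl = mult_carrier_mat[where nr=n and n=n and nc=n]
  define W where "W = mat_adjoint V * U"
  have cW: "W \<in> carrier_mat n n" using cV' cU by (simp add: W_def)
  have cD: "?D x \<in> carrier_mat n n" for x by simp
  have left: "mat_adjoint V * (U * ?D x * mat_adjoint U) * U = W * ?D x" for x
    using cU cV' cU' cD[of x] U2 unfolding W_def
    by (simp add: assoc cl right_mult_one_mat[of _ n n])
  have right: "mat_adjoint V * (V * ?D x * mat_adjoint V) * U = ?D x * W" for x
  proof -
    have "mat_adjoint V * (V * ?D x * mat_adjoint V) * U
        = (mat_adjoint V * V) * ?D x * (mat_adjoint V * U)"
      using cU cV' cV cD[of x]
      by (simp add: assoc cl)
    then show ?thesis using V2 cD[of x] by (simp add: W_def)
  qed
  have "W * ?D d = ?D e * W" using left[of d] right[of e] AU AV by simp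
  moreover have l: "(W * ?D x) $$ (i, j) = W $$ (i, j) * complex_of_real (x j)"
    and r: "(?D x * W) $$ (i, j) = complex_of_real (x i) * W $$ (i, j)"
    if "i < n" "j < n" for x i j
    using that mat_diag_mult_left[OF cW] mat_diag_mult_right[OF cW] by auto
  ultimately have comm: "W $$ (i, j) = 0 \<or> d j = e i" if "i < n" "j < n" for i j
    using that by (metis mult.commute mult_cancel_left of_real_eq_iff)
  have eq: "W * ?D (\<lambda>i. h (d i)) = ?D (\<lambda>i. h (e i)) * W"
  proof (rule eq_matI)
    fix i j assume "i < dim_row (?D (\<lambda>i. h (e i)) * W)" "j < dim_col (?D (\<lambda>i. h (e i)) * W)"
    then have ij: "i < n" "j < n" using cW by (auto simp: mat_diag_def)
    show "(W * ?D (\<lambda>i. h (d i))) $$ (i, j) = (?D (\<lambda>i. h (e i)) * W) $$ (i, j)"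
      using comm[OF ij] l[OF ij, of "\<lambda>i. h (d i)"] r[OF ij, of "\<lambda>i. h (e i)"] by auto
  qed (use cW in \<open>auto simp: mat_diag_def\<close>)
  have cB: "B \<in> carrier_mat n n" and cC: "C \<in> carrier_mat n n"
    using cU cV cU' cV' cD by (simp_all add: BU CV cl)
  have "mat_adjoint V * B * U = mat_adjoint V * C * U"
    using left[of "\<lambda>i. h (d i)"] right[of "\<lambda>i. h (e i)"] eq BU CV by simp
  then have "V * (mat_adjoint V * B * U) * mat_adjoint U
           = V * (mat_adjoint V * C * U) * mat_adjoint U" by simp
  moreover have "V * (mat_adjoint V * M * U) * mat_adjoint U = M"
    if M: "M \<in> carrier_mat n n" for M
  proof -
    have "V * (mat_adjoint V * M * U) * mat_adjoint U
        = (V * mat_adjoint V) * M * (U * mat_adjoint U)"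
      using cU cV' cV cU' M
      by (simp add: assoc cl)
    then show ?thesis using V1 U1 M by simp
  qed
  ultimately show ?thesis using cB cC by simp
qed

lemma mat_fun_eq:
  assumes "spectral_decomp n A U d"
  shows "mat_fun h A = U * mat_diag n (\<lambda>i. complex_of_real (h (d i))) * mat_adjoint U"
    (is "_ = ?B")
proof -
  have U: "U \<in> carrier_mat n n" and A: "A = U * mat_diag n (\<lambda>i. complex_of_real (d i)) * mat_adjoint U"
    using assms by (auto simp: spectral_decomp_def unitary_mat_def)
  have n: "dim_row A = n" using U by (subst A) simp
  have B: "spectral_decomp n ?B U (\<lambda>i. h (d i))"
    using assms by (simp add: spectral_decomp_def)
  show ?thesis
    unfolding mat_fun_def n
    using assms B spectral_decomp_fun_unique by (intro the_equality) blast+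
qed


section \<open>Quantum f-divergences\<close>

text \<open>
  A quantum f-divergence is a single function on pairs of states of all dimensions; the
  dimension is carried by the matrices.
\<close>

definition quantum_f_divergence ::
  "(real \<Rightarrow> real) \<Rightarrow> (complex mat \<Rightarrow> complex mat \<Rightarrow> ereal) \<Rightarrow> bool" where
  "quantum_f_divergence f D \<longleftrightarrow>
     (\<forall>n \<rho> \<sigma>. quantum_state n \<rho> \<longrightarrow> quantum_state n \<sigma> \<longrightarrow> 0 \<le> D \<rho> \<sigma>) \<and>
     (\<forall>n \<rho> \<sigma> U p q. quantum_state n \<rho> \<longrightarrow> quantum_state n \<sigma> \<longrightarrow> \<rho> * \<sigma> = \<sigma> * \<rho> \<longrightarrow>
        spectral_decomp n \<rho> U p \<longrightarrow> spectral_decomp n \<sigma> U q \<longrightarrow>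
        D \<rho> \<sigma> = classical_f_div f n p q) \<and>
     (\<forall>n m W \<rho> \<sigma>. quantum_channel n m W \<longrightarrow> quantum_state n \<rho> \<longrightarrow> quantum_state n \<sigma> \<longrightarrow>
        D (W \<rho>) (W \<sigma>) \<le> D \<rho> \<sigma>)"

definition D_max :: "(real \<Rightarrow> real) \<Rightarrow> complex mat \<Rightarrow> complex mat \<Rightarrow> complex" where
  "D_max g \<rho> \<sigma> =
     (let S = mat_fun sqrt \<sigma>; R = mat_fun (\<lambda>x. 1 / sqrt x) \<sigma>
      in mat_trace (S * mat_fun g (R * \<rho> * R) * S))"

end

theory Submission
  imports Defs
begin

text \<open>
  The pair \<open>(\<rho>, \<sigma>)\<close> is the image of a pair of commuting states under a channel
  (a reverse test).  Diagonalise \<open>\<sigma>\<^sup>-\<^sup>1\<^sup>/\<^sup>2 \<rho> \<sigma>\<^sup>-\<^sup>1\<^sup>/\<^sup>2\<close> with eigenvectors \<open>u\<^sub>i\<close> and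
  eigenvalues \<open>d\<^sub>i\<close>, and let \<open>q\<^sub>i = \<langle>u\<^sub>i, \<sigma> u\<^sub>i\<rangle>\<close>, \<open>p\<^sub>i = d\<^sub>i q\<^sub>i\<close>.  The channel that
  measures in the standard basis and prepares the unit vector
  \<open>\<sigma>\<^sup>1\<^sup>/\<^sup>2 u\<^sub>i / \<surd>q\<^sub>i\<close> upon outcome \<open>i\<close> sends \<open>diag p\<close> to \<open>\<rho>\<close> and \<open>diag q\<close> to \<open>\<sigma>\<close>, while
  \<open>D\<^sub>g(p\<parallel>q) = \<Sum>\<^sub>i q\<^sub>i g(d\<^sub>i)\<close> is exactly the maximal divergence of \<open>\<rho>\<close> and \<open>\<sigma>\<close>.
\<close>

section \<open>Adjoints and diagonal matrices\<close>

lemma dim_mat_adjoint [simp]: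
  "dim_row (mat_adjoint A) = dim_col A" "dim_col (mat_adjoint A) = dim_row A"
  by (simp_all add: mat_adjoint_def)

lemma index_mat_adjoint:
  fixes A :: "complex mat"
  assumes "i < dim_col A" "j < dim_row A"
  shows "mat_adjoint A $$ (i, j) = cnj (A $$ (j, i))"
  using assms by (simp add: mat_adjoint_def mat_of_rows_index)

lemma index_mult_mat_sum:
  assumes "A \<in> carrier_mat m n" "B \<in> carrier_mat n l" "i < m" "j < l"
  shows "(A * B) $$ (i, j) = (\<Sum>k<n. A $$ (i, k) * B $$ (k, j))"
  using assms by (auto simp: scalar_prod_def atLeast0LessThan intro!: sum.cong)

lemma mat_adjoint_adjoint [simp]: "mat_adjoint (mat_adjoint A) = (A :: complex mat)"
  by (rule eq_matI) (auto simp: index_mat_adjoint)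

lemma mat_adjoint_mult:
  fixes A B :: "complex mat"
  assumes "A \<in> carrier_mat m n" "B \<in> carrier_mat n l"
  shows "mat_adjoint (A * B) = mat_adjoint B * mat_adjoint A"
proof (rule eq_matI)
  fix i j assume "i < dim_row (mat_adjoint B * mat_adjoint A)"
    "j < dim_col (mat_adjoint B * mat_adjoint A)"
  then have ij: "i < l" "j < m" using assms by auto
  have "mat_adjoint (A * B) $$ (i, j) = cnj ((A * B) $$ (j, i))"
    using assms ij by (intro index_mat_adjoint) auto
  also have "\<dots> = (\<Sum>k<n. cnj (A $$ (j, k)) * cnj (B $$ (k, i)))"
    using index_mult_mat_sum[OF assms ij(2,1)] by simp
  also have "\<dots> = (mat_adjoint B * mat_adjoint A) $$ (i, j)"
    using assms ij by (subst index_mult_mat_sum[OF mat_adjoint_carrier mat_adjoint_carrier])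
      (auto simp: index_mat_adjoint mult.commute intro!: sum.cong)
  finally show "mat_adjoint (A * B) $$ (i, j) = (mat_adjoint B * mat_adjoint A) $$ (i, j)" .
qed (use assms in auto)

abbreviation real_diag :: "nat \<Rightarrow> (nat \<Rightarrow> real) \<Rightarrow> complex mat" where
  "real_diag n d \<equiv> mat_diag n (\<lambda>i. complex_of_real (d i))"

lemma mat_adjoint_real_diag [simp]: "mat_adjoint (real_diag n d) = real_diag n d"
  by (rule eq_matI) (auto simp: index_mat_adjoint mat_diag_def)

lemma mat_adjoint_one [simp]: "mat_adjoint (1\<^sub>m n) = (1\<^sub>m n :: complex mat)"
  by (rule eq_matI) (auto simp: index_mat_adjoint)

lemma index_mat_diag_conj:
  fixes K :: "complex mat"
  assumes "K \<in> carrier_mat m n" "r < m" "c < m"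
  shows "(K * mat_diag n x * mat_adjoint K) $$ (r, c)
       = (\<Sum>i<n. K $$ (r, i) * x i * cnj (K $$ (c, i)))"
  using assms
  by (subst index_mult_mat_sum[OF mult_carrier_mat[OF assms(1)] mat_adjoint_carrier])
    (auto simp: mat_diag_mult_right index_mat_adjoint intro!: sum.cong)

text \<open>Cyclicity of the trace, written out in entries: the diagonal of
  \<open>mat_adjoint K * K\<close> lists the squared lengths of the columns of \<open>K\<close>. It
  yields trace preservation of the channel, and later the total masses and the divergence of the
  reverse test.\<close>

lemma mat_trace_diag_conj:
  fixes K :: "complex mat"
  assumes K: "K \<in> carrier_mat m n"
  shows "mat_trace (K * mat_diag n x * mat_adjoint K) = (\<Sum>i<n. x i * (mat_adjoint K * K) $$ (i, i))"
proof -
  have "mat_trace (K * mat_diag n x * mat_adjoint K)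
      = (\<Sum>r<m. \<Sum>i<n. K $$ (r, i) * x i * cnj (K $$ (r, i)))"
    using K index_mat_diag_conj[OF K] by (simp add: mat_trace_def)
  also have "\<dots> = (\<Sum>i<n. \<Sum>r<m. K $$ (r, i) * x i * cnj (K $$ (r, i)))"
    by (rule sum.swap)
  also have "\<dots> = (\<Sum>i<n. x i * (mat_adjoint K * K) $$ (i, i))"
  proof (rule sum.cong)
    fix i assume "i \<in> {..<n}"
    then show "(\<Sum>r<m. K $$ (r, i) * x i * cnj (K $$ (r, i))) = x i * (mat_adjoint K * K) $$ (i, i)"
      using K by (subst index_mult_mat_sum[OF mat_adjoint_carrier[OF K] K])
        (auto simp: index_mat_adjoint sum_distrib_left mult_ac intro!: sum.cong)
  qed simp
  finally show ?thesis .
qed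

section \<open>The spectral theorem\<close>

lemma unitary_mat_mult:
  assumes "unitary_mat n U" "unitary_mat n V"
  shows "unitary_mat n (U * V)"
proof -
  have c: "U \<in> carrier_mat n n" "V \<in> carrier_mat n n"
    and e: "U * mat_adjoint U = 1\<^sub>m n" "mat_adjoint U * U = 1\<^sub>m n"
      "V * mat_adjoint V = 1\<^sub>m n" "mat_adjoint V * V = 1\<^sub>m n"
    using assms by (auto simp: unitary_mat_def)
  note c' = c[THEN mat_adjoint_carrier]
  note assoc = assoc_mult_mat[where n\<^sub>1=n and n\<^sub>2=n and n\<^sub>3=n and n\<^sub>4=n]
  have "U * V * (mat_adjoint V * mat_adjoint U) = U * ((V * mat_adjoint V) * mat_adjoint U)"
    "mat_adjoint V * mat_adjoint U * (U * V) = mat_adjoint V * ((mat_adjoint U * U) * V)"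
    using c c' by (simp_all add: assoc mult_carrier_mat[where n=n])
  then show ?thesis using c c' e by (simp add: unitary_mat_def mat_adjoint_mult)
qed

text \<open>Completing \<open>v\<close> to a basis and applying Gram-Schmidt gives an orthogonal
  family that still starts with \<open>v\<close>. Dividing each column by its length makes the
  matrix unitary and only rescales \<open>v\<close>. This is the change of basis for the deflation
  in the spectral theorem.\<close>

lemma unitary_mat_with_first_col:
  assumes v: "v \<in> carrier_vec n" and v0: "v \<noteq> 0\<^sub>v n"
  shows "\<exists>W c. unitary_mat n W \<and> col W 0 = c \<cdot>\<^sub>v v"
proof -
  interpret cof_vec_space n "TYPE(complex)" .
  define b where "b = basis_completion v"
  define ws where "ws = gram_schmidt n b"
  define W where "W = mat_of_cols n ws"
  have n: "n \<noteq> 0" using v v0 by auto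
  note bc = basis_completion[OF v v0, folded b_def]
  from bc(6,7) n obtain vs where bv: "b = v # vs" by (cases b) auto
  from gram_schmidt_result[OF bc(2,4,5) refl, folded ws_def]
  have ws: "set ws \<subseteq> carrier_vec n" "corthogonal ws" "length ws = n" by (auto simp: bc(6))
  have hd: "hd ws = v" using gram_schmidt_hd[OF v, of vs, folded bv] by (simp add: ws_def)
  have W: "W \<in> carrier_mat n n" using ws by (auto simp: W_def)
  have col0: "col W 0 = v" using ws n hd v by (cases ws) (auto simp: W_def)
  have orth: "corthogonal_mat W" unfolding W_def using orthogonal_mat_of_cols ws by blast
  \<comment> \<open>The Gram matrix of the columns. Orthogonality makes it diagonal with nonzero,
    not necessarily unit, diagonal entries.\<close>
  define G where "G = mat_adjoint W * W"
  note W' = mat_adjoint_carrier[OF W]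
  have G: "G \<in> carrier_mat n n" using W W' by (simp add: G_def)
  have off: "G $$ (i, j) = 0" if "i < n" "j < n" "i \<noteq> j" for i j
    using orth that G W unfolding corthogonal_mat_def Let_def G_def[symmetric] diagonal_mat_def by auto
  have nz: "G $$ (i, i) \<noteq> 0" if "i < n" for i
    using orth that W unfolding corthogonal_mat_def Let_def G_def[symmetric] by auto
  define N where "N i = (\<Sum>k<n. (cmod (W $$ (k, i)))\<^sup>2)" for i
  have GN: "G $$ (i, i) = of_real (N i)" if "i < n" for i
    using that W unfolding G_def
    by (subst index_mult_mat_sum[OF W' W])
      (auto simp: index_mat_adjoint N_def complex_norm_square mult.commute simp del: of_real_power
        intro!: sum.cong)
  have N0: "N i > 0" if "i < n" for i
  proof -
    have "N i \<ge> 0" by (simp add: N_def sum_nonneg)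
    moreover have "N i \<noteq> 0" using GN[OF that] nz[OF that] by auto
    ultimately show ?thesis by simp
  qed
  \<comment> \<open>Multiplication by \<open>F\<close> from the right divides column
    \<open>i\<close> by its length \<open>sqrt (N i)\<close>.\<close>
  define F where "F = real_diag n (\<lambda>i. 1 / sqrt (N i))"
  have F: "F \<in> carrier_mat n n" by (simp add: F_def)
  have FG: "F * G * F = 1\<^sub>m n"
  proof (rule eq_matI)
    fix i j assume "i < dim_row (1\<^sub>m n :: complex mat)" "j < dim_col (1\<^sub>m n :: complex mat)"
    then have ij: "i < n" "j < n" by auto
    have "(F * G * F) $$ (i, j)
        = complex_of_real (1 / sqrt (N i)) * G $$ (i, j) * complex_of_real (1 / sqrt (N j))"
      using ij G mat_diag_mult_right[of "F * G" n n "\<lambda>i. complex_of_real (1 / sqrt (N i))"]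
        mat_diag_mult_left[OF G, of "\<lambda>i. complex_of_real (1 / sqrt (N i))"]
      by (simp add: F_def)
    moreover have "complex_of_real (1 / sqrt (N i)) * G $$ (i, i) * complex_of_real (1 / sqrt (N i)) = 1"
      using N0[OF ij(1)] GN[OF ij(1)]
      by (simp flip: of_real_mult)
    ultimately show "(F * G * F) $$ (i, j) = 1\<^sub>m n $$ (i, j)"
      using ij off[OF ij] by auto
  qed (use F G in auto)
  define Z where "Z = W * F"
  have Z: "Z \<in> carrier_mat n n" using W F by (simp add: Z_def)
  have aZ: "mat_adjoint Z = F * mat_adjoint W"
    unfolding Z_def mat_adjoint_mult[OF W F] unfolding F_def mat_adjoint_real_diag ..
  have "mat_adjoint Z * Z = F * G * F"
    unfolding aZ unfolding Z_def G_def using W W' F by (simp add: assoc_mult_mat[where n\<^sub>1=n and n\<^sub>2=n and n\<^sub>3=n and n\<^sub>4=n])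
  then have "mat_adjoint Z * Z = 1\<^sub>m n" using FG by simp
  then have "unitary_mat n Z"
    using Z mat_mult_left_right_inverse[OF mat_adjoint_carrier[OF Z] Z] by (simp add: unitary_mat_def)
  moreover have "col Z 0 = complex_of_real (1 / sqrt (N 0)) \<cdot>\<^sub>v v"
  proof (rule eq_vecI)
    fix i assume "i < dim_vec (complex_of_real (1 / sqrt (N 0)) \<cdot>\<^sub>v v)"
    then have i: "i < n" using v by simp
    have "W $$ (i, 0) = v $ i" using col0 W i n by (metis carrier_matD index_col not_gr_zero)
    then show "col Z 0 $ i = (complex_of_real (1 / sqrt (N 0)) \<cdot>\<^sub>v v) $ i"
      using i n Z v mat_diag_mult_right[OF W, of "\<lambda>i. complex_of_real (1 / sqrt (N i))"]
      by (simp add: Z_def F_def)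
  qed (use Z v in auto)
  ultimately show ?thesis by blast
qed

text \<open>Deflation by induction on the dimension. In an orthonormal basis starting with an
  eigenvector, the first column vanishes below the corner; being Hermitian, the matrix then splits
  into a real scalar and a Hermitian block of size \<open>n\<close>, to which the induction
  hypothesis applies.\<close>

theorem spectral_decomp_exists:
  assumes "A \<in> carrier_mat n n" "mat_adjoint A = A"
  shows "\<exists>U d. spectral_decomp n A U d"
  using assms
proof (induction n arbitrary: A)
  case 0
  then have "spectral_decomp 0 A (1\<^sub>m 0) (\<lambda>_. 0)"
    by (auto simp: spectral_decomp_def unitary_mat_def)
  then show ?case by blast
next
  case (Suc n)
  note A = Suc.prems(1)
  \<comment> \<open>Over the complex numbers the characteristic polynomial splits; its list of roots
    has length \<open>Suc n\<close>, so it has a head, which is an eigenvalue.\<close>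
  obtain as where "char_poly A = (\<Prod>a\<leftarrow>as. [:- a, 1:])" "length as = Suc n"
    using char_poly_factorized[OF A] by blast
  then have "poly (char_poly A) (hd as) = 0" by (cases as) auto
  then have "eigenvalue A (hd as)" by (simp add: eigenvalue_root_char_poly[OF A])
  then obtain v e where v: "v \<in> carrier_vec (Suc n)" "v \<noteq> 0\<^sub>v (Suc n)" and Av: "A *\<^sub>v v = e \<cdot>\<^sub>v v"
    using A unfolding eigenvalue_def eigenvector_def by auto
  obtain W c where uW: "unitary_mat (Suc n) W" and W0: "col W 0 = c \<cdot>\<^sub>v v"
    using unitary_mat_with_first_col[OF v] by blast
  have W: "W \<in> carrier_mat (Suc n) (Suc n)" and W1: "W * mat_adjoint W = 1\<^sub>m (Suc n)"
    and W2: "mat_adjoint W * W = 1\<^sub>m (Suc n)" using uW by (auto simp: unitary_mat_def)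
  note W' = mat_adjoint_carrier[OF W]
  note assoc = assoc_mult_mat[where n\<^sub>1="Suc n" and n\<^sub>2="Suc n" and n\<^sub>3="Suc n" and n\<^sub>4="Suc n"]
  note cl = mult_carrier_mat[where n="Suc n" and nr="Suc n" and nc="Suc n"]
  define A' where "A' = mat_adjoint W * (A * W)"
  have A': "A' \<in> carrier_mat (Suc n) (Suc n)" using A W W' by (simp add: A'_def)
  have adjA': "mat_adjoint A' = A'"
    unfolding A'_def using A W W' Suc.prems(2)
    by (simp add: mat_adjoint_mult[OF W' cl[OF A W]] mat_adjoint_mult[OF A W] assoc)
  have herm: "A' $$ (i, j) = cnj (A' $$ (j, i))" if "i < Suc n" "j < Suc n" for i j
    using index_mat_adjoint[of i A' j] adjA' A' that by simp
  \<comment> \<open>Column \<open>0\<close> of \<open>W\<close> is a multiple of the eigenvector, so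
    \<open>A\<close> maps it to \<open>e\<close> times itself, and the columns of \<open>W\<close>
    are orthonormal.\<close>
  have col0: "A' $$ (i, 0) = (if i = 0 then e else 0)" if i: "i < Suc n" for i
  proof -
    have "A *\<^sub>v col W 0 = e \<cdot>\<^sub>v col W 0"
      using A v Av by (simp add: W0 mult_mat_vec smult_smult_assoc mult.commute)
    then have "col (A * W) 0 = e \<cdot>\<^sub>v col W 0"
      using W A col_mult2[OF A W] by simp
    then have "A' $$ (i, 0) = row (mat_adjoint W) i \<bullet> (e \<cdot>\<^sub>v col W 0)"
      unfolding A'_def using A W W' i by simp
    also have "\<dots> = e * (row (mat_adjoint W) i \<bullet> col W 0)"
      using W W' by simp
    also have "row (mat_adjoint W) i \<bullet> col W 0 = (mat_adjoint W * W) $$ (i, 0)"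
      using W W' i by simp
    finally show ?thesis using W2 i by simp
  qed
  \<comment> \<open>\<open>e\<close> is a diagonal entry of the Hermitian matrix \<open>A'\<close>,
    hence real.\<close>
  have e: "e = complex_of_real (Re e)"
    using herm[of 0 0] col0[of 0] by (simp add: complex_eq_iff)
  have row0: "A' $$ (0, j) = (if j = 0 then e else 0)" if "j < Suc n" for j
    using herm[of 0 j] col0[of j] col0[of 0] that by (auto split: if_splits)
  define B where "B = mat n n (\<lambda>(i, j). A' $$ (Suc i, Suc j))"
  have B: "B \<in> carrier_mat n n" by (simp add: B_def)
  have "mat_adjoint B = B"
    by (rule eq_matI) (auto simp: index_mat_adjoint B_def herm[symmetric])
  then obtain V d where "spectral_decomp n B V d" using Suc.IH[OF B] by blast
  then have V: "V \<in> carrier_mat n n" and V1: "V * mat_adjoint V = 1\<^sub>m n"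
    and V2: "mat_adjoint V * V = 1\<^sub>m n" and BV: "B = V * real_diag n d * mat_adjoint V"
    by (auto simp: spectral_decomp_def unitary_mat_def)
  note V' = mat_adjoint_carrier[OF V]
  \<comment> \<open>\<open>?b x X\<close> is the direct sum of the scalar \<open>x\<close> and the
    block \<open>X\<close>. It respects products, adjoints and the identity, so a diagonalisation of
    \<open>B\<close> extends to one of \<open>A'\<close>.\<close>
  let ?b = "\<lambda>x X. four_block_mat (mat 1 1 (\<lambda>_. x)) (0\<^sub>m 1 n) (0\<^sub>m n 1) X :: complex mat"
  have blk_mult: "?b x X * ?b y Y = ?b (x * y) (X * Y)"
    if "X \<in> carrier_mat n n" "Y \<in> carrier_mat n n" for x y X Y
  proof -
    have "mat 1 1 (\<lambda>_. x) * mat 1 1 (\<lambda>_. y) = (mat 1 1 (\<lambda>_. x * y) :: complex mat)"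
      by (rule eq_matI) (auto simp: scalar_prod_def)
    then show ?thesis using that
      by (subst mult_four_block_mat[of _ 1 1 _ n _ n _ _ 1 _ n]) auto
  qed
  have blk_adj: "mat_adjoint (?b x X) = ?b (cnj x) (mat_adjoint X)" if "X \<in> carrier_mat n n" for x X
    using that by (intro eq_matI) (auto simp: index_mat_adjoint)
  have blk_one: "?b 1 (1\<^sub>m n) = 1\<^sub>m (Suc n)"
    by (rule eq_matI) auto
  \<comment> \<open>The new eigenvalue takes index \<open>0\<close> and those of \<open>B\<close>
    move up by one.\<close>
  let ?d = "case_nat (Re e) d"
  have blk_diag: "?b e (real_diag n d) = real_diag (Suc n) ?d"
    using e by (intro eq_matI) (auto simp: mat_diag_def split: nat.split)
  have blk_A: "?b e B = A'"
    using A' row0 col0 by (intro eq_matI) (auto simp: B_def)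
  define V1' where "V1' = ?b 1 V"
  have cV1: "V1' \<in> carrier_mat (Suc n) (Suc n)" using V by (auto simp: V1'_def)
  note cV1' = mat_adjoint_carrier[OF cV1]
  have aV1: "mat_adjoint V1' = ?b 1 (mat_adjoint V)" using blk_adj[OF V, of 1] by (simp add: V1'_def)
  have uV1: "unitary_mat (Suc n) V1'"
    using V V' cV1 V1 V2 blk_one unfolding unitary_mat_def aV1
    by (simp add: V1'_def blk_mult del: One_nat_def)
  have A'V: "A' = V1' * real_diag (Suc n) ?d * mat_adjoint V1'"
    unfolding blk_diag[symmetric] blk_A[symmetric] aV1 using V V'
    by (simp add: V1'_def blk_mult BV mult_carrier_mat[where n=n] del: One_nat_def)
  let ?D = "real_diag (Suc n) ?d"
  have "W * V1' * ?D * mat_adjoint (W * V1') = W * (V1' * ?D * mat_adjoint V1') * mat_adjoint W"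
    using W W' cV1 cV1' by (simp add: mat_adjoint_mult[OF W cV1] assoc cl)
  also have "\<dots> = (W * mat_adjoint W) * A * (W * mat_adjoint W)"
    unfolding A'V[symmetric] unfolding A'_def using W W' A by (simp add: assoc cl)
  also have "\<dots> = A" using A W1 by simp
  finally have "spectral_decomp (Suc n) A (W * V1') ?d"
    using unitary_mat_mult[OF uW uV1] by (simp add: spectral_decomp_def)
  then show ?case by blast
qed

section \<open>Positive semidefinite matrices\<close>

lemma quadratic_form_mat_adjoint:
  fixes K :: "complex mat"
  assumes K: "K \<in> carrier_mat m n" and v: "v \<in> carrier_vec n" and w: "w \<in> carrier_vec m"
  shows "(K *\<^sub>v v) \<bullet>c w = v \<bullet>c (mat_adjoint K *\<^sub>v w)"
proof -
  have "(K *\<^sub>v v) \<bullet>c w = (\<Sum>i<m. \<Sum>j<n. K $$ (i, j) * v $ j * cnj (w $ i))"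
    using assms by (auto simp: scalar_prod_def atLeast0LessThan sum_distrib_right intro!: sum.cong)
  also have "\<dots> = (\<Sum>j<n. \<Sum>i<m. K $$ (i, j) * v $ j * cnj (w $ i))"
    by (rule sum.swap)
  also have "\<dots> = v \<bullet>c (mat_adjoint K *\<^sub>v w)"
    using assms by (auto simp: scalar_prod_def atLeast0LessThan sum_distrib_left index_mat_adjoint
        mult_ac intro!: sum.cong)
  finally show ?thesis .
qed

text \<open>Moving \<open>K\<close> to the other side of the inner product evaluates the quadratic
  form of \<open>A\<close> at \<open>mat_adjoint K *\<^sub>v v\<close>.\<close>

lemma psd_congruence:
  assumes A: "psd n A" and K: "K \<in> carrier_mat m n"
  shows "psd m (K * A * mat_adjoint K)"
proof -
  have cA: "A \<in> carrier_mat n n" and aA: "mat_adjoint A = A"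
    and pA: "\<And>v. v \<in> carrier_vec n \<Longrightarrow> 0 \<le> Re ((A *\<^sub>v v) \<bullet>c v)"
    using A by (auto simp: psd_def)
  note K' = mat_adjoint_carrier[OF K]
  have "mat_adjoint (K * A * mat_adjoint K) = K * A * mat_adjoint K"
    using K K' cA aA mat_adjoint_mult[OF mult_carrier_mat[OF K cA] K'] mat_adjoint_mult[OF K cA]
    by (simp add: assoc_mult_mat[OF K cA K'])
  moreover have "0 \<le> Re ((K * A * mat_adjoint K *\<^sub>v v) \<bullet>c v)" if v: "v \<in> carrier_vec m" for v
  proof -
    have Kv: "mat_adjoint K *\<^sub>v v \<in> carrier_vec n" using K' v by auto
    have "K * A * mat_adjoint K *\<^sub>v v = K *\<^sub>v (A *\<^sub>v (mat_adjoint K *\<^sub>v v))"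
      using K K' cA v Kv by (simp add: assoc_mult_mat_vec[of _ m n _ n] assoc_mult_mat_vec[of _ m n _ m])
    then have "(K * A * mat_adjoint K *\<^sub>v v) \<bullet>c v
        = (A *\<^sub>v (mat_adjoint K *\<^sub>v v)) \<bullet>c (mat_adjoint K *\<^sub>v v)"
      using quadratic_form_mat_adjoint[OF K _ v] cA Kv by auto
    then show ?thesis using pA[OF Kv] by simp
  qed
  ultimately show ?thesis using K K' cA by (auto simp: psd_def)
qed

lemma psd_diag_entry:
  assumes "psd n A" "i < n"
  shows "0 \<le> Re (A $$ (i, i))" "A $$ (i, i) = of_real (Re (A $$ (i, i)))"
proof -
  have A: "A \<in> carrier_mat n n" and aA: "mat_adjoint A = A"
    and pA: "0 \<le> Re ((A *\<^sub>v unit_vec n i) \<bullet>c unit_vec n i)"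
    using assms by (auto simp: psd_def)
  have "conjugate (unit_vec n i) = (unit_vec n i :: complex vec)"
    by (rule eq_vecI) (auto simp: unit_vec_def)
  then have "(A *\<^sub>v unit_vec n i) \<bullet>c unit_vec n i = A $$ (i, i)"
    using A assms(2) by simp
  then show "0 \<le> Re (A $$ (i, i))" using pA by simp
  show "A $$ (i, i) = of_real (Re (A $$ (i, i)))"
    using index_mat_adjoint[of i A i] A aA assms(2) by (simp add: complex_eq_iff)
qed

lemma psd_real_diag:
  assumes "\<And>i. i < n \<Longrightarrow> 0 \<le> d i"
  shows "psd n (real_diag n d)"
proof -
  have "0 \<le> Re ((real_diag n d *\<^sub>v v) \<bullet>c v)" if v: "v \<in> carrier_vec n" for v
  proof -
    have "(real_diag n d *\<^sub>v v) $ i = d i * v $ i" if "i < n" for i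
      using v that by (simp add: mat_diag_def scalar_prod_def if_distrib[of "\<lambda>x. x * _"] cong: if_cong)
    then have "(real_diag n d *\<^sub>v v) \<bullet>c v = (\<Sum>i<n. d i * v $ i * cnj (v $ i))"
      using v by (auto simp: scalar_prod_def atLeast0LessThan intro!: sum.cong)
    also have "\<dots> = complex_of_real (\<Sum>i<n. d i * (cmod (v $ i))\<^sup>2)"
      by (simp add: complex_norm_square mult.assoc del: of_real_power)
    finally show ?thesis using assms by (auto intro!: sum_nonneg)
  qed
  then show ?thesis by (simp add: psd_def)
qed

text \<open>The sum is described by entries because the dimension is not part of the matrix type.
  Quadratic forms are linear in the entries, so nonnegativity passes to the sum.\<close>

lemma psd_sum:
  assumes B: "\<And>i. i \<in> I \<Longrightarrow> psd n (B i)" and A: "A \<in> carrier_mat n n"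
    and AB: "\<And>r c. r < n \<Longrightarrow> c < n \<Longrightarrow> A $$ (r, c) = (\<Sum>i\<in>I. B i $$ (r, c))"
  shows "psd n A"
proof -
  have cB: "B i \<in> carrier_mat n n" and aB: "mat_adjoint (B i) = B i"
    and pB: "\<And>v. v \<in> carrier_vec n \<Longrightarrow> 0 \<le> Re ((B i *\<^sub>v v) \<bullet>c v)" if "i \<in> I" for i
    using B[OF that] by (auto simp: psd_def)
  have "cnj (A $$ (c, r)) = A $$ (r, c)" if "r < n" "c < n" for r c
  proof -
    have "cnj (B i $$ (c, r)) = B i $$ (r, c)" if "i \<in> I" for i
      using index_mat_adjoint[of r "B i" c] aB[OF that] cB[OF that] \<open>r < n\<close> \<open>c < n\<close> by simp
    then show ?thesis using AB that by simp
  qed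
  then have "mat_adjoint A = A"
    using A by (intro eq_matI) (auto simp: index_mat_adjoint)
  moreover have "0 \<le> Re ((A *\<^sub>v v) \<bullet>c v)" if v: "v \<in> carrier_vec n" for v
  proof -
    have form: "(X *\<^sub>v v) \<bullet>c v = (\<Sum>r<n. \<Sum>c<n. X $$ (r, c) * (v $ c * cnj (v $ r)))"
      if "X \<in> carrier_mat n n" for X
      using that v
      by (auto simp: scalar_prod_def atLeast0LessThan sum_distrib_right mult.assoc intro!: sum.cong)
    have "(A *\<^sub>v v) \<bullet>c v = (\<Sum>r<n. \<Sum>c<n. \<Sum>i\<in>I. B i $$ (r, c) * (v $ c * cnj (v $ r)))"
      using form[OF A] AB by (simp add: sum_distrib_right)
    also have "\<dots> = (\<Sum>r<n. \<Sum>i\<in>I. \<Sum>c<n. B i $$ (r, c) * (v $ c * cnj (v $ r)))"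
      by (intro sum.cong refl sum.swap)
    also have "\<dots> = (\<Sum>i\<in>I. \<Sum>r<n. \<Sum>c<n. B i $$ (r, c) * (v $ c * cnj (v $ r)))"
      by (rule sum.swap)
    also have "\<dots> = (\<Sum>i\<in>I. (B i *\<^sub>v v) \<bullet>c v)"
      using form cB by simp
    finally show ?thesis using pB v by (simp add: sum_nonneg)
  qed
  ultimately show ?thesis using A by (simp add: psd_def)
qed

section \<open>Measure-and-prepare channels\<close>

text \<open>Only the diagonal of \<open>X\<close> is read: outcome \<open>i\<close> has weight
  \<open>X $$ (i, i)\<close> and prepares the rank-one operator given by column \<open>i\<close> of
  \<open>K\<close>. The columns are arbitrary here; unit length is asked for only where the trace
  matters.\<close>

definition measure_prepare :: "nat \<Rightarrow> complex mat \<Rightarrow> complex mat \<Rightarrow> complex mat" where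
  "measure_prepare n K X = K * mat_diag n (\<lambda>i. X $$ (i, i)) * mat_adjoint K"

lemma index_measure_prepare:
  assumes "K \<in> carrier_mat m n" "r < m" "c < m"
  shows "measure_prepare n K X $$ (r, c) = (\<Sum>i<n. K $$ (r, i) * X $$ (i, i) * cnj (K $$ (c, i)))"
  using index_mat_diag_conj[OF assms] by (simp add: measure_prepare_def)

lemma measure_prepare_carrier:
  "K \<in> carrier_mat m n \<Longrightarrow> measure_prepare n K X \<in> carrier_mat m m"
  by (auto simp: measure_prepare_def)

text \<open>The Kraus form: the ampliation is a sum over the outcomes \<open>i\<close> of
  congruences of \<open>X\<close>, each of which preserves positivity.\<close>

lemma completely_positive_measure_prepare:
  assumes K: "K \<in> carrier_mat m n"
  shows "completely_positive n m (measure_prepare n K)"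
  unfolding completely_positive_def
proof (intro allI impI)
  fix k X assume X: "psd (k * n) X"
  then have cX: "X \<in> carrier_mat (k * n) (k * n)" by (simp add: psd_def)
  \<comment> \<open>\<open>L i\<close> is the tensor product of the identity with the Kraus operator \<open>K e\<^sub>i e\<^sub>i\<^sup>*\<close>.\<close>
  define L where "L i = mat (k * m) (k * n)
    (\<lambda>(I, A). if A = (I div m) * n + i then K $$ (I mod m, i) else 0)" for i
  have L: "L i \<in> carrier_mat (k * m) (k * n)" for i by (simp add: L_def)
  show "psd (k * m) (ampliation k n m (measure_prepare n K) X)"
  proof (rule psd_sum[where I="{..<n}"])
    show "psd (k * m) (L i * X * mat_adjoint (L i))" for i
      by (rule psd_congruence[OF X L])
    show "ampliation k n m (measure_prepare n K) X \<in> carrier_mat (k * m) (k * m)"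
      by (simp add: ampliation_def)
    fix I J assume IJ: "I < k * m" "J < k * m"
    then have m: "0 < m" by (cases m) auto
    have d: "I div m < k" "J div m < k" using IJ m by (auto simp: less_mult_imp_div_less)
    \<comment> \<open>Each row of \<open>L i\<close> has at most one nonzero entry, so both matrix
      products collapse to a single term.\<close>
    have "(L i * X * mat_adjoint (L i)) $$ (I, J)
        = K $$ (I mod m, i) * X $$ ((I div m) * n + i, (J div m) * n + i) * cnj (K $$ (J mod m, i))"
      if i: "i < n" for i
    proof -
      have bound: "a * n + i < k * n" if "a < k" for a
      proof -
        have "a * n + i < (a + 1) * n" using i by simp
        also have "\<dots> \<le> k * n" using that by (intro mult_right_mono) auto
        finally show ?thesis .
      qed
      have LX: "(L i * X) $$ (I, B) = K $$ (I mod m, i) * X $$ ((I div m) * n + i, B)"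
        if "B < k * n" for B
        using bound[OF d(1)] IJ that
        by (subst index_mult_mat_sum[OF L cX])
          (auto simp: L_def if_distrib[of "\<lambda>x. x * _"] cong: if_cong)
      have "(L i * X * mat_adjoint (L i)) $$ (I, J)
          = (\<Sum>B<k * n. (L i * X) $$ (I, B) * cnj (L i $$ (J, B)))"
        using L[of i] IJ
        by (subst index_mult_mat_sum[OF mult_carrier_mat[OF L cX] mat_adjoint_carrier[OF L]])
          (auto simp: index_mat_adjoint intro!: sum.cong)
      also have "\<dots> = (\<Sum>B<k * n. if B = (J div m) * n + i
          then K $$ (I mod m, i) * X $$ ((I div m) * n + i, B) * cnj (K $$ (J mod m, i)) else 0)"
        using LX IJ by (intro sum.cong) (auto simp: L_def)
      also have "\<dots> = K $$ (I mod m, i) * X $$ ((I div m) * n + i, (J div m) * n + i)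
          * cnj (K $$ (J mod m, i))"
        using bound[OF d(2)] by simp
      finally show ?thesis .
    qed
    then show "ampliation k n m (measure_prepare n K) X $$ (I, J)
        = (\<Sum>i<n. (L i * X * mat_adjoint (L i)) $$ (I, J))"
      using IJ m by (simp add: ampliation_def index_measure_prepare[OF K] block_def)
  qed
qed

text \<open>Columns of length one mean that every prepared operator has trace one, which gives trace
  preservation.\<close>

lemma quantum_channel_measure_prepare:
  assumes K: "K \<in> carrier_mat m n" and unit: "\<And>i. i < n \<Longrightarrow> (mat_adjoint K * K) $$ (i, i) = 1"
  shows "quantum_channel n m (measure_prepare n K)"
proof -
  note c = measure_prepare_carrier[OF K]
  note c_dim = carrier_matD[OF c]
  have "linear_map n m (measure_prepare n K)"
    unfolding linear_map_def
  proof (intro conjI ballI allI c)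
    fix A B :: "complex mat" assume "A \<in> carrier_mat n n" "B \<in> carrier_mat n n"
    then show "measure_prepare n K (A + B) = measure_prepare n K A + measure_prepare n K B"
      by (intro eq_matI) (auto simp: c_dim index_measure_prepare[OF K] algebra_simps sum.distrib)
  next
    fix z and A :: "complex mat" assume "A \<in> carrier_mat n n"
    then show "measure_prepare n K (z \<cdot>\<^sub>m A) = z \<cdot>\<^sub>m measure_prepare n K A"
      by (intro eq_matI) (auto simp: c_dim index_measure_prepare[OF K] sum_distrib_left mult_ac
          intro!: sum.cong)
  qed
  moreover have "trace_preserving n (measure_prepare n K)"
    unfolding trace_preserving_def measure_prepare_def mat_trace_diag_conj[OF K]
    using unit by (auto simp: mat_trace_def)
  ultimately show ?thesis
    using completely_positive_measure_prepare[OF K] by (simp add: quantum_channel_def)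
qed

section \<open>Reverse tests\<close>

lemma quantum_state_real_diag:
  assumes "prob_dist n p"
  shows "quantum_state n (real_diag n p)"
proof -
  have "mat_trace (real_diag n p) = complex_of_real (\<Sum>i<n. p i)"
    by (simp add: mat_trace_def mat_diag_def)
  also have "\<dots> = 1" using assms by (simp add: prob_dist_def del: of_real_sum)
  finally show ?thesis
    using assms psd_real_diag[of n p] by (simp add: quantum_state_def prob_dist_def)
qed

lemma spectral_decomp_real_diag: "spectral_decomp n (real_diag n p) (1\<^sub>m n) p"
  by (simp add: spectral_decomp_def unitary_mat_def right_mult_one_mat[of _ n n]
      left_mult_one_mat[of _ n n])

text \<open>Data processing bounds the divergence of the outputs by that of the inputs. The inputs
  are diagonal, so they commute and share the standard eigenbasis, where the divergence is
  classical.\<close>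

lemma quantum_f_divergence_le_classical:
  assumes D: "quantum_f_divergence f D" and W: "quantum_channel k n W"
    and p: "prob_dist k p" and q: "prob_dist k q"
  shows "D (W (real_diag k p)) (W (real_diag k q)) \<le> classical_f_div f k p q"
proof -
  have "D (W (real_diag k p)) (W (real_diag k q)) \<le> D (real_diag k p) (real_diag k q)"
    using D W quantum_state_real_diag[OF p] quantum_state_real_diag[OF q]
    unfolding quantum_f_divergence_def by blast
  moreover have "real_diag k p * real_diag k q = real_diag k q * real_diag k p"
    by (simp add: mult.commute)
  then have "D (real_diag k p) (real_diag k q) = classical_f_div f k p q"
    using D quantum_state_real_diag[OF p] quantum_state_real_diag[OF q]
      spectral_decomp_real_diag[of k p] spectral_decomp_real_diag[of k q]
    unfolding quantum_f_divergence_def by blast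
  ultimately show ?thesis by simp
qed

section \<open>Positivity of eigenvalues and of diagonal entries\<close>

lemma spectral_decomp_conj:
  assumes "spectral_decomp n A U d"
  shows "mat_adjoint U * A * U = real_diag n d"
proof -
  have U: "U \<in> carrier_mat n n" and 1: "mat_adjoint U * U = 1\<^sub>m n"
    and A: "A = U * real_diag n d * mat_adjoint U"
    using assms by (auto simp: spectral_decomp_def unitary_mat_def)
  note U' = mat_adjoint_carrier[OF U]
  have "mat_adjoint U * A * U = (mat_adjoint U * U) * real_diag n d * (mat_adjoint U * U)"
    unfolding A using U U' by (simp add: assoc_mult_mat[where n\<^sub>1=n and n\<^sub>2=n and n\<^sub>3=n and n\<^sub>4=n] mult_carrier_mat[where n=n])
  then show ?thesis using 1 by (simp add: left_mult_one_mat[of _ n n] right_mult_one_mat[of _ n n])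
qed

lemma psd_spectral_decomp_nonneg:
  assumes "psd n A" "spectral_decomp n A U d" "i < n"
  shows "0 \<le> d i"
proof -
  have "U \<in> carrier_mat n n" using assms by (simp add: spectral_decomp_def unitary_mat_def)
  then have "psd n (real_diag n d)"
    using psd_congruence[OF assms(1) mat_adjoint_carrier] spectral_decomp_conj[OF assms(2)]
    by fastforce
  from psd_diag_entry(1)[OF this assms(3)] show ?thesis using assms(3) by (simp add: mat_diag_def)
qed

text \<open>Conjugating an inverse of \<open>A\<close> by \<open>U\<close> gives a right inverse of
  the diagonal matrix, and its entry \<open>(i, i)\<close> times \<open>d i\<close> equals
  one.\<close>

lemma invertible_spectral_decomp_nonzero:
  assumes "invertible_mat A" "spectral_decomp n A U d" "i < n"
  shows "d i \<noteq> 0"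
proof -
  have U: "U \<in> carrier_mat n n" and 1: "U * mat_adjoint U = 1\<^sub>m n" "mat_adjoint U * U = 1\<^sub>m n"
    and Aeq: "A = U * real_diag n d * mat_adjoint U"
    using assms(2) by (auto simp: spectral_decomp_def unitary_mat_def)
  note U' = mat_adjoint_carrier[OF U]
  have A: "A \<in> carrier_mat n n" unfolding Aeq
    by (rule mult_carrier_mat[OF mult_carrier_mat[OF U mat_diag_dim] U'])
  obtain B where AB: "A * B = 1\<^sub>m n" and BA: "B * A = 1\<^sub>m (dim_row B)"
    using assms(1) A by (auto simp: invertible_mat_def inverts_mat_def)
  have "dim_col B = n" using arg_cong[OF AB, of dim_col] by simp
  moreover have "dim_row B = n" using arg_cong[OF BA, of dim_col] A by simp
  ultimately have B: "B \<in> carrier_mat n n" by auto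
  let ?C = "mat_adjoint U * B * U"
  have C: "?C \<in> carrier_mat n n" using U U' B by simp
  have "real_diag n d * ?C = mat_adjoint U * A * (U * mat_adjoint U) * B * U"
    unfolding spectral_decomp_conj[OF assms(2), symmetric] using U U' A B
    by (simp add: assoc_mult_mat[where n\<^sub>1=n and n\<^sub>2=n and n\<^sub>3=n and n\<^sub>4=n] mult_carrier_mat[where n=n])
  also have "\<dots> = mat_adjoint U * (A * B) * U"
    unfolding 1 using U U' A B
    by (simp add: assoc_mult_mat[where n\<^sub>1=n and n\<^sub>2=n and n\<^sub>3=n and n\<^sub>4=n] mult_carrier_mat[where n=n])
  also have "\<dots> = 1\<^sub>m n" using U' 1 by (simp add: AB right_mult_one_mat[of _ n n])
  finally have "(real_diag n d * ?C) $$ (i, i) = 1" using assms(3) by simp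
  then show ?thesis using assms(3) mat_diag_mult_left[OF C, of "\<lambda>i. complex_of_real (d i)"] by auto
qed

text \<open>The diagonal entry is an average of the \<open>s k\<close> with weights
  \<open>(cmod (U $$ (i, k)))\<^sup>2\<close>. It ensures that the weights \<open>q\<close> of the
  reverse test are positive and can be divided by.\<close>

lemma unitary_mat_congruence_diag_pos:
  assumes U: "unitary_mat n U" and s: "\<And>k. k < n \<Longrightarrow> 0 < s k" and i: "i < n"
  shows "0 < Re ((U * real_diag n s * mat_adjoint U) $$ (i, i))"
proof -
  have cU: "U \<in> carrier_mat n n" and U1: "U * mat_adjoint U = 1\<^sub>m n"
    using U by (auto simp: unitary_mat_def)
  \<comment> \<open>Row \<open>i\<close> has length one, so some weight is nonzero.\<close>
  have "(\<Sum>k<n. U $$ (i, k) * cnj (U $$ (i, k))) = 1"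
    using index_mult_mat_sum[OF cU mat_adjoint_carrier[OF cU] i i] U1 i cU
    by (auto simp: index_mat_adjoint)
  then obtain k where k: "k < n" "U $$ (i, k) \<noteq> 0"
    by (metis (no_types, lifting) lessThan_iff mult_zero_left sum.neutral zero_neq_one)
  have "(U * real_diag n s * mat_adjoint U) $$ (i, i)
      = (\<Sum>k<n. U $$ (i, k) * s k * cnj (U $$ (i, k)))"
    by (rule index_mat_diag_conj[OF cU i i])
  also have "\<dots> = complex_of_real (\<Sum>k<n. s k * (cmod (U $$ (i, k)))\<^sup>2)"
    by (simp add: complex_norm_square mult_ac del: of_real_power)
  finally have "Re ((U * real_diag n s * mat_adjoint U) $$ (i, i))
      = (\<Sum>k<n. s k * (cmod (U $$ (i, k)))\<^sup>2)" by simp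
  moreover have "0 < (\<Sum>k<n. s k * (cmod (U $$ (i, k)))\<^sup>2)"
    using k s by (intro sum_pos2[of _ k]) (auto simp: less_imp_le)
  ultimately show ?thesis by simp
qed

text \<open>A single triple \<open>W\<close>, \<open>p\<close>, \<open>q\<close> serves every
  \<open>g\<close>, since it is built from eigenvectors and eigenvalues on which \<open>g\<close>
  has no influence.\<close>

theorem reverse_test_exists:
  assumes \<rho>: "quantum_state n \<rho>" and \<sigma>: "quantum_state n \<sigma>" and inv: "invertible_mat \<sigma>"
  obtains W p q where "quantum_channel n n W" "prob_dist n p" "prob_dist n q"
    "W (real_diag n p) = \<rho>" "W (real_diag n q) = \<sigma>"
    "\<And>g. classical_f_div g n p q = ereal (Re (D_max g \<rho> \<sigma>))"
proof -
  note assoc = assoc_mult_mat[where n\<^sub>1=n and n\<^sub>2=n and n\<^sub>3=n and n\<^sub>4=n]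
  note cl = mult_carrier_mat[where n=n and nr=n and nc=n]
  note one = left_mult_one_mat[of _ n n] right_mult_one_mat[of _ n n]
  have c\<rho>: "\<rho> \<in> carrier_mat n n" and p\<rho>: "psd n \<rho>" and t\<rho>: "mat_trace \<rho> = 1"
    using \<rho> by (auto simp: quantum_state_def psd_def)
  have c\<sigma>: "\<sigma> \<in> carrier_mat n n" and p\<sigma>: "psd n \<sigma>" and t\<sigma>: "mat_trace \<sigma> = 1"
    using \<sigma> by (auto simp: quantum_state_def psd_def)
  obtain V s where Vs: "spectral_decomp n \<sigma> V s"
    using spectral_decomp_exists[OF c\<sigma>] p\<sigma> by (auto simp: psd_def)
  have uV: "unitary_mat n V" using Vs by (simp add: spectral_decomp_def)
  then have V: "V \<in> carrier_mat n n" and V1: "V * mat_adjoint V = 1\<^sub>m n"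
    and V2: "mat_adjoint V * V = 1\<^sub>m n" by (auto simp: unitary_mat_def)
  note V' = mat_adjoint_carrier[OF V]
  have s: "0 < s i" if "i < n" for i
    using psd_spectral_decomp_nonneg[OF p\<sigma> Vs that]
      invertible_spectral_decomp_nonzero[OF inv Vs that] by simp
  have V_mult: "V * real_diag n x * mat_adjoint V * (V * real_diag n y * mat_adjoint V)
      = V * real_diag n (\<lambda>i. x i * y i) * mat_adjoint V" for x y
  proof -
    have "V * real_diag n x * mat_adjoint V * (V * real_diag n y * mat_adjoint V)
        = V * real_diag n x * (mat_adjoint V * V) * real_diag n y * mat_adjoint V"
      using V V' by (simp add: assoc cl)
    also have "\<dots> = V * (real_diag n x * real_diag n y) * mat_adjoint V"
      unfolding V2 using V V' by (simp add: assoc cl one)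
    finally show ?thesis by simp
  qed
  define S where "S = mat_fun sqrt \<sigma>"
  define R where "R = mat_fun (\<lambda>x. 1 / sqrt x) \<sigma>"
  have S_eq: "S = V * real_diag n (\<lambda>i. sqrt (s i)) * mat_adjoint V"
    and R_eq: "R = V * real_diag n (\<lambda>i. 1 / sqrt (s i)) * mat_adjoint V"
    using mat_fun_eq[OF Vs] by (simp_all add: S_def R_def)
  have S: "S \<in> carrier_mat n n" and R: "R \<in> carrier_mat n n"
    using V V' unfolding S_eq R_eq by (simp_all add: cl)
  have V_adj: "mat_adjoint (V * real_diag n x * mat_adjoint V) = V * real_diag n x * mat_adjoint V" for x
    using V V' by (simp add: mat_adjoint_mult[where m=n and n=n and l=n] assoc cl)
  have aS: "mat_adjoint S = S" and aR: "mat_adjoint R = R" unfolding S_eq R_eq V_adj by simp_all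
  have diag_cong: "mat_diag n x = mat_diag n y" if "\<And>i. i < n \<Longrightarrow> x i = y i" for x y :: "nat \<Rightarrow> complex"
    using that by (intro eq_matI) (auto simp: mat_diag_def)
  have "real_diag n (\<lambda>i. sqrt (s i) * sqrt (s i)) = real_diag n s"
    by (rule diag_cong) (use s in \<open>force simp flip: of_real_mult\<close>)
  then have SS: "S * S = \<sigma>" using Vs unfolding S_eq V_mult by (simp add: spectral_decomp_def)
  have "real_diag n (\<lambda>i. sqrt (s i) * (1 / sqrt (s i))) = 1\<^sub>m n"
    unfolding mat_diag_one[symmetric] by (rule diag_cong) (use s in force)
  then have SR: "S * R = 1\<^sub>m n" using V V1 V' unfolding S_eq R_eq V_mult by (simp add: one)
  then have RS: "R * S = 1\<^sub>m n" using mat_mult_left_right_inverse[OF S R] by simp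
  define T where "T = R * \<rho> * R"
  have pT: "psd n T" using psd_congruence[OF p\<rho> R] by (simp add: aR T_def)
  then have T: "T \<in> carrier_mat n n" and aT: "mat_adjoint T = T" by (auto simp: psd_def)
  obtain U d where Ud: "spectral_decomp n T U d" using spectral_decomp_exists[OF T aT] by blast
  have uU: "unitary_mat n U" using Ud by (simp add: spectral_decomp_def)
  then have U: "U \<in> carrier_mat n n" and U1: "U * mat_adjoint U = 1\<^sub>m n"
    and U2: "mat_adjoint U * U = 1\<^sub>m n" by (auto simp: unitary_mat_def)
  note U' = mat_adjoint_carrier[OF U]
  have d0: "0 \<le> d i" if "i < n" for i
    using psd_spectral_decomp_nonneg[OF pT Ud that] .
  \<comment> \<open>Column \<open>i\<close> of \<open>M\<close> is \<open>S\<close> applied to the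
    eigenvector \<open>i\<close> of \<open>T\<close>: the prepared vector before normalisation, with
    squared length \<open>q i\<close>.\<close>
  define M where "M = S * U"
  have M: "M \<in> carrier_mat n n" using S U by (simp add: M_def)
  note M' = mat_adjoint_carrier[OF M]
  have aM: "mat_adjoint M = mat_adjoint U * S" by (simp add: M_def mat_adjoint_mult[OF S U] aS)
  \<comment> \<open>With \<open>X\<close> the identity, \<open>real_diag n d\<close> and
    \<open>real_diag n (\<lambda>i. g (d i))\<close>, this form yields \<sigma>, \<rho> and the
    operator whose trace is \<open>D_max g \<rho> \<sigma>\<close>.\<close>
  have M_conj: "M * X * mat_adjoint M = S * (U * X * mat_adjoint U) * S"
    if "X \<in> carrier_mat n n" for X
    unfolding aM unfolding M_def using that S U U' by (simp add: assoc cl)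
  \<comment> \<open>The Gram matrix of \<open>M\<close> is \<sigma> in the basis \<open>U\<close>;
    diagonalising \<sigma> brings it to the form in which its diagonal is known to be
    positive.\<close>
  have MM: "mat_adjoint M * M = mat_adjoint U * V * real_diag n s * mat_adjoint (mat_adjoint U * V)"
  proof -
    have "mat_adjoint M * M = mat_adjoint U * (S * S) * U"
      unfolding aM unfolding M_def using S U U' by (simp add: assoc cl)
    also have "\<dots> = mat_adjoint U * (V * real_diag n s * mat_adjoint V) * U"
      using SS Vs by (simp add: spectral_decomp_def)
    finally show ?thesis
      using U U' V V' by (simp add: mat_adjoint_mult[OF U' V] assoc cl)
  qed
  define q where "q i = Re ((mat_adjoint M * M) $$ (i, i))" for i
  have uUV: "unitary_mat n (mat_adjoint U * V)"
    using uV U U' U1 U2 by (intro unitary_mat_mult) (auto simp: unitary_mat_def)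
  have q0: "0 < q i" if "i < n" for i
    unfolding q_def MM by (rule unitary_mat_congruence_diag_pos[OF uUV s that])
  \<comment> \<open>As a congruence of the identity, the Gram matrix has a real diagonal, so taking
    the real part in \<open>q\<close> loses nothing.\<close>
  have "psd n (mat_adjoint M * M)"
    using psd_congruence[OF psd_real_diag[of n "\<lambda>_. 1"] M'] M M' by (simp add: one)
  then have q: "(mat_adjoint M * M) $$ (i, i) = of_real (q i)" if "i < n" for i
    unfolding q_def using psd_diag_entry(2) that by blast
  have trM: "mat_trace (M * real_diag n x * mat_adjoint M) = of_real (\<Sum>i<n. x i * q i)" for x
    using q by (simp add: mat_trace_diag_conj[OF M])
  have M_one: "M * real_diag n (\<lambda>_. 1) * mat_adjoint M = \<sigma>"
    using S U U' by (simp add: M_conj U1 one SS)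
  have M_d: "M * real_diag n d * mat_adjoint M = \<rho>"
  proof -
    have "M * real_diag n d * mat_adjoint M = S * T * S"
      using Ud by (simp add: M_conj spectral_decomp_def)
    also have "\<dots> = (S * R) * \<rho> * (R * S)"
      unfolding T_def using S R c\<rho> by (simp add: assoc cl)
    finally show ?thesis using c\<rho> by (simp add: SR RS)
  qed
  define p where "p i = d i * q i" for i
  have pd_q: "prob_dist n q"
    using q0 trM[of "\<lambda>_. 1"] M_one t\<sigma> by (auto simp: prob_dist_def less_imp_le simp flip: of_real_sum)
  have pd_p: "prob_dist n p"
    using q0 d0 trM[of d] M_d t\<rho>
    by (auto simp: prob_dist_def p_def less_imp_le simp flip: of_real_sum of_real_mult)
  \<comment> \<open>Normalises the columns of \<open>M\<close> to unit length, as the channel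
    requires.\<close>
  define K where "K = M * real_diag n (\<lambda>i. 1 / sqrt (q i))"
  have K: "K \<in> carrier_mat n n" using M by (simp add: K_def)
  have aK: "mat_adjoint K = real_diag n (\<lambda>i. 1 / sqrt (q i)) * mat_adjoint M"
    unfolding K_def mat_adjoint_mult[OF M mat_diag_dim] mat_adjoint_real_diag ..
  have "(mat_adjoint K * K) $$ (i, i) = 1" if i: "i < n" for i
  proof -
    let ?F = "real_diag n (\<lambda>i. 1 / sqrt (q i))"
    have MMc: "mat_adjoint M * M \<in> carrier_mat n n" using M M' by simp
    have "mat_adjoint K * K = ?F * (mat_adjoint M * M) * ?F"
      unfolding aK unfolding K_def using M M' by (simp add: assoc cl)
    then have "(mat_adjoint K * K) $$ (i, i)
        = complex_of_real (1 / sqrt (q i)) * of_real (q i) * complex_of_real (1 / sqrt (q i))"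
      using i q[OF i] MMc mat_diag_mult_left[OF MMc, of "\<lambda>i. complex_of_real (1 / sqrt (q i))"]
        mat_diag_mult_right[of "?F * (mat_adjoint M * M)" n n "\<lambda>i. complex_of_real (1 / sqrt (q i))"]
      by simp
    then show ?thesis using q0[OF i] by (simp flip: of_real_mult)
  qed
  then have channel: "quantum_channel n n (measure_prepare n K)"
    by (rule quantum_channel_measure_prepare[OF K])
  \<comment> \<open>The weight \<open>q i\<close> of outcome \<open>i\<close> cancels the two
    factors \<open>1 / sqrt (q i)\<close> that the normalised vector brings in.\<close>
  have prep: "measure_prepare n K (real_diag n (\<lambda>i. x i * q i)) = M * real_diag n x * mat_adjoint M" for x
  proof -
    let ?F = "real_diag n (\<lambda>i. 1 / sqrt (q i))"
    have "measure_prepare n K (real_diag n (\<lambda>i. x i * q i))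
        = K * real_diag n (\<lambda>i. x i * q i) * mat_adjoint K"
      unfolding measure_prepare_def
      by (intro arg_cong[where f="\<lambda>X. K * X * mat_adjoint K"] diag_cong) (simp add: mat_diag_def)
    also have "\<dots> = M * (?F * real_diag n (\<lambda>i. x i * q i) * ?F) * mat_adjoint M"
      unfolding aK unfolding K_def using M M' by (simp add: assoc cl del: mat_diag_diag)
    also have "?F * real_diag n (\<lambda>i. x i * q i) * ?F = real_diag n x"
      unfolding mat_diag_diag
    proof (rule diag_cong)
      fix i assume "i < n"
      have "1 / sqrt (q i) * (x i * q i) * (1 / sqrt (q i)) = x i"
        using q0[OF \<open>i < n\<close>] by (simp add: field_simps)
      then show "complex_of_real (1 / sqrt (q i)) * complex_of_real (x i * q i)
          * complex_of_real (1 / sqrt (q i)) = complex_of_real (x i)"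
        by (simp only: of_real_mult[symmetric])
    qed
    finally show ?thesis .
  qed
  have "measure_prepare n K (real_diag n p) = \<rho>" "measure_prepare n K (real_diag n q) = \<sigma>"
    using prep[of d] prep[of "\<lambda>_. 1"] M_d M_one by (simp_all add: p_def)
  moreover have "classical_f_div g n p q = ereal (Re (D_max g \<rho> \<sigma>))" for g
  proof -
    have "classical_f_div g n p q = (\<Sum>i<n. ereal (g (d i) * q i))"
      unfolding classical_f_div_def
    proof (rule sum.cong)
      fix i assume "i \<in> {..<n}"
      \<comment> \<open>Thus only the finite branch of \<open>f_div_term\<close> occurs, and
        \<open>p i / q i\<close> is the eigenvalue \<open>d i\<close>.\<close>
      then have "q i \<noteq> 0" using q0[of i] by auto
      then show "f_div_term g (p i) (q i) = ereal (g (d i) * q i)"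
        by (simp add: f_div_term_def p_def)
    qed simp
    moreover have "D_max g \<rho> \<sigma> = mat_trace (M * real_diag n (\<lambda>i. g (d i)) * mat_adjoint M)"
      by (simp add: D_max_def Let_def M_conj mat_fun_eq[OF Ud]
          flip: S_def R_def T_def)
    ultimately show ?thesis by (simp add: trM)
  qed
  ultimately show thesis using that channel pd_p pd_q by blast
qed

theorem corollary1:
  fixes f g :: "real \<Rightarrow> real" and \<phi> :: "ereal \<Rightarrow> ereal"
    and D :: "complex mat \<Rightarrow> complex mat \<Rightarrow> ereal"
    and n :: nat and \<rho> \<sigma> :: "complex mat"
  assumes "convex_on {0..} f" and "convex_on {0..} g"
    and "f 1 = 0" and "g 1 = 0"
    and "\<And>k p q. prob_dist k p \<Longrightarrow> prob_dist k q \<Longrightarrow>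
           classical_f_div f k p q \<le> \<phi> (classical_f_div g k p q)"
    and "quantum_f_divergence f D"
    and "quantum_state n \<rho>" and "quantum_state n \<sigma>" and "invertible_mat \<sigma>"
  shows "D \<rho> \<sigma> \<le> \<phi> (ereal (Re (D_max g \<rho> \<sigma>)))"
proof -
  obtain W p q where W: "quantum_channel n n W" "prob_dist n p" "prob_dist n q"
    "W (real_diag n p) = \<rho>" "W (real_diag n q) = \<sigma>"
    "classical_f_div g n p q = ereal (Re (D_max g \<rho> \<sigma>))"
    using reverse_test_exists[OF assms(7-9)] by metis
  have "D \<rho> \<sigma> \<le> classical_f_div f n p q"
    using quantum_f_divergence_le_classical[OF assms(6) W(1-3)] W(4,5) by simp
  \<comment> \<open>The classical divergence for \<open>g\<close> equals the maximal one exactly, so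
    the arbitrary function \<phi> is evaluated at the same point.\<close>
  also have "\<dots> \<le> \<phi> (classical_f_div g n p q)" using assms(5) W(2,3) by blast
  finally show ?thesis using W(6) by simp
qed

end
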